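(* Let $A$ be a nest algebra, and let $T: A\to A$ be a continuous linear map. Then $T$ is anti-derivable at zero if, and only if, there exist $u,v \in A$ such that $u-v \in \mathcal{Z}(A)$, $T(a) = a u - v a$ for all $a\in A$, and $[b a, u ] + 2 (u-v) b a = 0$ for all $a,b\in A$ with $a b = 0$.
   Context: $[x,y]=xy-yx$, and $\mathcal{Z}(A)$ denotes the center of $A$. Let $H$ be a separable complex Hilbert space. A subspace lattice on $H$ is a collection $\mathcal{L}$ of closed subspaces of $H$ containing $\{0\}$ and $H$ and closed under arbitrary intersections and arbitrary closed linear spans. $Alg(\mathcal{L})=\{S\in B(H): S(L)\subseteq L \text{ for all } L\in\mathcal{L}\}$. A nest algebra is an algebra of the form $Alg(\mathcal{L})$ where $\mathcal{L}$ is a totally ordered (by inclusion) subspace lattice. A linear map $T:A\to A$ is anti-derivable at zero if $T(b) a + b T(a)=0$ whenever $a,b\in A$ and $ab=0$. *)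

theory Defs
  imports "HOL-Analysis.Analysis"
begin

section \<open>Complex Hilbert spaces\<close>

text \<open>
  The inner product is linear in the first argument. The axiom
  \<open>scaleR_scaleC\<close> says that the real vector space structure of the superclass is the
  restriction of scalars, and \<open>cinner_self\<close> says that the norm is the one induced by
  the inner product; positive definiteness follows from it.
\<close>

class complex_inner = real_normed_vector +
  fixes scaleC :: "complex \<Rightarrow> 'a \<Rightarrow> 'a" (infixr \<open>*\<^sub>C\<close> 75)
    and cinner :: "'a \<Rightarrow> 'a \<Rightarrow> complex"
  assumes scaleC_add_right: "c *\<^sub>C (x + y) = c *\<^sub>C x + c *\<^sub>C y"
    and scaleC_add_left: "(c + d) *\<^sub>C x = c *\<^sub>C x + d *\<^sub>C x"
    and scaleC_scaleC: "c *\<^sub>C d *\<^sub>C x = (c * d) *\<^sub>C x"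
    and scaleR_scaleC: "r *\<^sub>R x = complex_of_real r *\<^sub>C x"
    and cinner_commute: "cinner x y = cnj (cinner y x)"
    and cinner_add_left: "cinner (x + y) z = cinner x z + cinner y z"
    and cinner_scaleC_left: "cinner (c *\<^sub>C x) y = c * cinner x y"
    and cinner_self: "cinner x x = complex_of_real ((norm x)\<^sup>2)"

class complex_hilbert = complex_inner + complete_space

instantiation complex :: complex_hilbert
begin

definition scaleC_complex :: "complex \<Rightarrow> complex \<Rightarrow> complex"
  where "scaleC_complex c x = c * x"

definition cinner_complex :: "complex \<Rightarrow> complex \<Rightarrow> complex"
  where "cinner_complex x y = x * cnj y"

instance
  by standard
    (simp_all add: scaleC_complex_def cinner_complex_def algebra_simps scaleR_conv_of_real
      complex_norm_square flip: of_real_power)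

end

global_interpretation complex_vector:
  vector_space "scaleC :: complex \<Rightarrow> 'a \<Rightarrow> 'a::complex_inner"
  defines csubspace = complex_vector.subspace
    and cspan = complex_vector.span
proof
  show "1 *\<^sub>C x = x" for x :: 'a
    using scaleR_scaleC[of 1 x] by simp
qed (simp_all add: scaleC_add_right scaleC_add_left scaleC_scaleC)

lemma norm_scaleC: "norm (c *\<^sub>C x) = cmod c * norm (x :: 'a::complex_inner)"
proof -
  have "complex_of_real ((norm (c *\<^sub>C x))\<^sup>2) = cinner (c *\<^sub>C x) (c *\<^sub>C x)"
    by (simp only: cinner_self)
  also have "\<dots> = c * cinner x (c *\<^sub>C x)"
    by (rule cinner_scaleC_left)
  also have "cinner x (c *\<^sub>C x) = cnj c * cinner x x"
    by (metis cinner_commute cinner_scaleC_left complex_cnj_mult)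
  also have "c * (cnj c * cinner x x) = complex_of_real ((cmod c * norm x)\<^sup>2)"
    by (simp add: cinner_self power_mult_distrib complex_norm_square mult.assoc
        del: of_real_power flip: of_real_power)
  finally have "(norm (c *\<^sub>C x))\<^sup>2 = (cmod c * norm x)\<^sup>2"
    by (simp only: of_real_eq_iff)
  then show ?thesis
    by (rule power2_eq_imp_eq) simp_all
qed

lemma bounded_linear_scaleC: "bounded_linear (\<lambda>x :: 'a::complex_inner. c *\<^sub>C x)"
  by (rule bounded_linear_intro[where K = "cmod c"])
    (simp_all add: scaleC_add_right scaleR_scaleC scaleC_scaleC norm_scaleC mult.commute)


section \<open>Bounded complex linear operators\<close>

text \<open>
  Elements of the type \<open>'a \<Rightarrow>\<^sub>L 'a\<close> are only real linear, so \<open>B(H)\<close> is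
  the set of those that commute with complex scalars. It carries the operator norm of the
  ambient type, and its product is \<open>(o\<^sub>L)\<close>.
\<close>

definition bounded_operators :: "('a::complex_inner \<Rightarrow>\<^sub>L 'a) set"
  where "bounded_operators = {S. \<forall>c x. blinfun_apply S (c *\<^sub>C x) = c *\<^sub>C blinfun_apply S x}"

lift_definition scale_operator ::
  "complex \<Rightarrow> ('a::complex_inner \<Rightarrow>\<^sub>L 'a) \<Rightarrow> ('a \<Rightarrow>\<^sub>L 'a)"
  is "\<lambda>c S x. c *\<^sub>C S x"
  by (rule bounded_linear_compose[OF bounded_linear_scaleC])

definition commutator ::
  "('a::real_normed_vector \<Rightarrow>\<^sub>L 'a) \<Rightarrow> ('a \<Rightarrow>\<^sub>L 'a) \<Rightarrow> ('a \<Rightarrow>\<^sub>L 'a)"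
  where "commutator x y = (x o\<^sub>L y) - (y o\<^sub>L x)"

definition center :: "('a::real_normed_vector \<Rightarrow>\<^sub>L 'a) set \<Rightarrow> ('a \<Rightarrow>\<^sub>L 'a) set"
  where "center A = {z \<in> A. \<forall>a\<in>A. commutator z a = 0}"


section \<open>Nest algebras\<close>

text \<open>The empty family is allowed in both closure conditions.\<close>

definition subspace_lattice :: "'a::complex_inner set set \<Rightarrow> bool"
  where "subspace_lattice \<L> \<longleftrightarrow>
    (\<forall>L\<in>\<L>. csubspace L \<and> closed L) \<and>
    {0} \<in> \<L> \<and> UNIV \<in> \<L> \<and>
    (\<forall>\<F>\<subseteq>\<L>. \<Inter>\<F> \<in> \<L>) \<and>
    (\<forall>\<F>\<subseteq>\<L>. closure (cspan (\<Union>\<F>)) \<in> \<L>)"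

definition Alg :: "'a::complex_inner set set \<Rightarrow> ('a \<Rightarrow>\<^sub>L 'a) set"
  where "Alg \<L> = {S \<in> bounded_operators. \<forall>L\<in>\<L>. blinfun_apply S ` L \<subseteq> L}"

definition nest_algebra :: "('a::complex_inner \<Rightarrow>\<^sub>L 'a) set \<Rightarrow> bool"
  where "nest_algebra A \<longleftrightarrow>
    (\<exists>\<L>. subspace_lattice \<L> \<and> (\<forall>K\<in>\<L>. \<forall>L\<in>\<L>. K \<subseteq> L \<or> L \<subseteq> K) \<and> A = Alg \<L>)"


section \<open>Linear maps on operator algebras\<close>

definition clinear_on ::
  "('a::complex_inner \<Rightarrow>\<^sub>L 'a) set \<Rightarrow> (('a \<Rightarrow>\<^sub>L 'a) \<Rightarrow> ('a \<Rightarrow>\<^sub>L 'a)) \<Rightarrow> bool"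
  where "clinear_on A T \<longleftrightarrow>
    (\<forall>a\<in>A. \<forall>b\<in>A. T (a + b) = T a + T b) \<and>
    (\<forall>c. \<forall>a\<in>A. T (scale_operator c a) = scale_operator c (T a))"

definition anti_derivable_at_zero ::
  "('a::real_normed_vector \<Rightarrow>\<^sub>L 'a) set \<Rightarrow> (('a \<Rightarrow>\<^sub>L 'a) \<Rightarrow> ('a \<Rightarrow>\<^sub>L 'a)) \<Rightarrow> bool"
  where "anti_derivable_at_zero A T \<longleftrightarrow>
    (\<forall>a\<in>A. \<forall>b\<in>A. a o\<^sub>L b = 0 \<longrightarrow> (T b o\<^sub>L a) + (b o\<^sub>L T a) = 0)"

end

theory Submission
  imports Defs
begin

text \<open>
  Let \<open>z = T 1\<close>. The idea is to show that \<open>z\<close> is central and that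
  \<open>D a = T a - z a\<close> is an inner derivation \<open>a \<mapsto> a v - v a\<close>; then
  \<open>u = v + z\<close> gives \<open>T a = a u - v a\<close>. For a map of this form, with
  \<open>u - v\<close> central, the expression \<open>T(b) a + b T(a)\<close> equals
  \<open>[b a, u] + 2 (u - v) b a\<close> identically (\<open>defect_of_generalized_derivation\<close>), so the
  commutator condition of the theorem is a rewriting of anti-derivability at zero.

  To reach this form, consider \<open>defect a b = T(b) a + b T(a)\<close>. If \<open>e\<close> is
  idempotent, the vanishing of the defect on zero products gives
  \<open>defect (a e) b = defect a (e b)\<close>. This ``balanced'' property is additive in
  \<open>e\<close>, so it holds for the off-diagonal elements \<open>p a q\<close> and \<open>q a p\<close>, where
  \<open>p\<close> is idempotent and \<open>q = 1 - p\<close>. Provided that \<open>p A q\<close> acts faithfully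
  from both sides, it follows that \<open>z\<close> is central (\<open>z_central\<close>) and that
  \<open>D(a b) = D(b) a + b D(a) + 2 z [b, a]\<close> whenever \<open>a\<close> or \<open>b\<close> is balanced
  (\<open>D_compose\<close>).

  It remains to find a good \<open>p\<close>. If the nest has an element \<open>N\<close> other than
  \<open>{0}\<close> and \<open>H\<close>, let \<open>p\<close> be the orthogonal projection onto
  \<open>N\<close>. Then \<open>q A p = 0\<close>, so \<open>A\<close> consists of block triangular operators,
  and the formula for \<open>D\<close> determines \<open>D\<close> on each of the three blocks:
  \<open>D\<close> is the inner derivation given by \<open>v = D p + 2 z p\<close>. If the nest is
  trivial, \<open>A\<close> is all of \<open>B(H)\<close> and \<open>p\<close> can be the projection onto any
  closed subspace other than these two. Computing \<open>D(e f g)\<close> in two ways yields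
  \<open>D(g) [e, f] + [g, f] D(e) = 0\<close>, which forces \<open>D = 0\<close>. If \<open>H\<close> has no such
  subspace, all operators are scalars and \<open>T a = z a\<close> by linearity.

  The argument about \<open>p\<close> is pure ring theory and is done in locales for a set
  of operators closed under the ring operations. Hilbert space geometry enters through the existence
  of orthogonal projections, and through rank-one operators, which provide the faithfulness.
\<close>

section \<open>The ring of bounded operators\<close>

lemmas compose_distribs =
  bounded_bilinear.add_left[OF bounded_bilinear_blinfun_compose]
  bounded_bilinear.add_right[OF bounded_bilinear_blinfun_compose]
  bounded_bilinear.diff_left[OF bounded_bilinear_blinfun_compose]
  bounded_bilinear.diff_right[OF bounded_bilinear_blinfun_compose]
  bounded_bilinear.minus_left[OF bounded_bilinear_blinfun_compose]
  bounded_bilinear.minus_right[OF bounded_bilinear_blinfun_compose]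

lemma compose_assoc: "(a o\<^sub>L b) o\<^sub>L c = a o\<^sub>L (b o\<^sub>L c)"
  by (rule blinfun_eqI) simp

lemma compose_id [simp]: "id_blinfun o\<^sub>L a = a" "a o\<^sub>L id_blinfun = a"
  by (rule blinfun_eqI, simp)+

lemmas compose_simps = compose_distribs compose_assoc

locale operator_ring =
  fixes A :: "('h::real_normed_vector \<Rightarrow>\<^sub>L 'h) set"
  assumes id_mem [simp]: "id_blinfun \<in> A"
    and add_mem [simp]: "a \<in> A \<Longrightarrow> b \<in> A \<Longrightarrow> a + b \<in> A"
    and diff_mem [simp]: "a \<in> A \<Longrightarrow> b \<in> A \<Longrightarrow> a - b \<in> A"
    and compose_mem [simp]: "a \<in> A \<Longrightarrow> b \<in> A \<Longrightarrow> a o\<^sub>L b \<in> A"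
begin

text \<open>
  Since \<open>u - v\<close> commutes with \<open>b\<close>, the inner terms \<open>b u a - b v a\<close> equal
  \<open>(u - v) b a\<close>. The outer ones, \<open>b a u - v b a\<close>, contribute the commutator
  and \<open>(u - v) b a\<close> once more.
\<close>

lemma defect_of_generalized_derivation:
  assumes ab: "a \<in> A" "b \<in> A" and central: "u - v \<in> center A"
    and T: "\<And>a. a \<in> A \<Longrightarrow> T a = (a o\<^sub>L u) - (v o\<^sub>L a)"
  shows "(T b o\<^sub>L a) + (b o\<^sub>L T a) =
    commutator (b o\<^sub>L a) u + 2 *\<^sub>R ((u - v) o\<^sub>L b o\<^sub>L a)"
proof -
  have "(u - v) o\<^sub>L b = b o\<^sub>L (u - v)"
    using central ab(2) by (simp add: center_def commutator_def)
  then have "(b o\<^sub>L (u - v)) o\<^sub>L a = ((u - v) o\<^sub>L b) o\<^sub>L a"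
    by simp
  then have "(b o\<^sub>L (u o\<^sub>L a)) = ((u o\<^sub>L (b o\<^sub>L a)) - (v o\<^sub>L (b o\<^sub>L a))) + (b o\<^sub>L (v o\<^sub>L a))"
    by (simp only: compose_simps diff_eq_eq)
  then show ?thesis
    by (simp add: T[OF ab(1)] T[OF ab(2)] commutator_def compose_simps scaleR_2)
qed

lemma anti_derivable_at_zero_iff:
  assumes "u - v \<in> center A" and "\<And>a. a \<in> A \<Longrightarrow> T a = (a o\<^sub>L u) - (v o\<^sub>L a)"
  shows "anti_derivable_at_zero A T \<longleftrightarrow> (\<forall>a\<in>A. \<forall>b\<in>A. a o\<^sub>L b = 0 \<longrightarrow>
    commutator (b o\<^sub>L a) u + 2 *\<^sub>R ((u - v) o\<^sub>L b o\<^sub>L a) = 0)"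
  unfolding anti_derivable_at_zero_def
  by (intro ball_cong imp_cong refl) (simp only: defect_of_generalized_derivation[OF _ _ assms])

end

section \<open>Moving idempotents across zero products\<close>

locale anti_derivable_map = operator_ring A
  for A :: "('h::real_normed_vector \<Rightarrow>\<^sub>L 'h) set" +
  fixes T :: "('h \<Rightarrow>\<^sub>L 'h) \<Rightarrow> ('h \<Rightarrow>\<^sub>L 'h)"
  assumes T_mem [simp]: "a \<in> A \<Longrightarrow> T a \<in> A"
    and T_add: "a \<in> A \<Longrightarrow> b \<in> A \<Longrightarrow> T (a + b) = T a + T b"
    and anti_derivable: "anti_derivable_at_zero A T"
begin

lemma T_diff: "a \<in> A \<Longrightarrow> b \<in> A \<Longrightarrow> T (a - b) = T a - T b"
  using T_add[of "a - b" b] by simp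

lemma zero_mem [simp]: "0 \<in> A"
  using diff_mem[OF id_mem id_mem] by simp

lemma T_zero [simp]: "T 0 = 0"
  using T_diff[of 0 0] by simp

text \<open>
  Anti-derivability at zero says that this biadditive expression vanishes on all pairs with
  product zero. Everything about \<open>T\<close> is extracted from moving factors between its two
  arguments.
\<close>

definition defect :: "('h \<Rightarrow>\<^sub>L 'h) \<Rightarrow> ('h \<Rightarrow>\<^sub>L 'h) \<Rightarrow> ('h \<Rightarrow>\<^sub>L 'h)"
  where "defect a b = (T b o\<^sub>L a) + (b o\<^sub>L T a)"

lemma defect_eq_0: "a \<in> A \<Longrightarrow> b \<in> A \<Longrightarrow> a o\<^sub>L b = 0 \<Longrightarrow> defect a b = 0"
  using anti_derivable unfolding anti_derivable_at_zero_def defect_def by blast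

lemma defect_diff_left:
  "a \<in> A \<Longrightarrow> a' \<in> A \<Longrightarrow> defect (a - a') b = defect a b - defect a' b"
  by (simp add: defect_def T_diff compose_distribs)

lemma defect_diff_right:
  "b \<in> A \<Longrightarrow> b' \<in> A \<Longrightarrow> defect a (b - b') = defect a b - defect a b'"
  by (simp add: defect_def T_diff compose_distribs)

text \<open>
  The elements that can be moved across the defect. In contrast to the idempotents, they form an
  additive group, which makes off-diagonal blocks available.
\<close>

definition balanced :: "('h \<Rightarrow>\<^sub>L 'h) \<Rightarrow> bool"
  where "balanced e \<longleftrightarrow>
    e \<in> A \<and> (\<forall>a\<in>A. \<forall>b\<in>A. defect (a o\<^sub>L e) b = defect a (e o\<^sub>L b))"

lemma balanced_mem [simp]: "balanced e \<Longrightarrow> e \<in> A"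
  unfolding balanced_def by blast

lemma balancedD:
  "balanced e \<Longrightarrow> a \<in> A \<Longrightarrow> b \<in> A \<Longrightarrow> defect (a o\<^sub>L e) b = defect a (e o\<^sub>L b)"
  unfolding balanced_def by blast

text \<open>
  Both \<open>(a e) (b - e b)\<close> and \<open>(a - a e) (e b)\<close> are zero, so the two
  sides agree with \<open>defect (a e) (e b)\<close>.
\<close>

lemma balanced_idempotent:
  assumes [simp]: "e \<in> A" and "e o\<^sub>L e = e"
  shows "balanced e"
  unfolding balanced_def
proof (intro conjI ballI)
  fix a b assume [simp]: "a \<in> A" "b \<in> A"
  have ee: "e o\<^sub>L (e o\<^sub>L x) = e o\<^sub>L x" for x :: "'h \<Rightarrow>\<^sub>L 'h"
    using assms(2) by (metis compose_assoc)
  have "defect (a o\<^sub>L e) (b - (e o\<^sub>L b)) = 0"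
    by (rule defect_eq_0) (simp_all add: compose_simps ee)
  then have "defect (a o\<^sub>L e) b = defect (a o\<^sub>L e) (e o\<^sub>L b)"
    by (simp add: defect_diff_right)
  also have "defect (a - (a o\<^sub>L e)) (e o\<^sub>L b) = 0"
    by (rule defect_eq_0) (simp_all add: compose_simps ee)
  then have "defect (a o\<^sub>L e) (e o\<^sub>L b) = defect a (e o\<^sub>L b)"
    by (simp add: defect_diff_left)
  finally show "defect (a o\<^sub>L e) b = defect a (e o\<^sub>L b)" .
qed (rule assms(1))

lemma balanced_diff:
  assumes "balanced e" and "balanced f"
  shows "balanced (e - f)"
  unfolding balanced_def
proof (intro conjI ballI)
  fix a b assume ab: "a \<in> A" "b \<in> A"
  have "defect (a o\<^sub>L (e - f)) b = defect (a o\<^sub>L e) b - defect (a o\<^sub>L f) b"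
    using assms ab by (simp add: compose_distribs defect_diff_left)
  also have "\<dots> = defect a (e o\<^sub>L b) - defect a (f o\<^sub>L b)"
    by (simp only: balancedD[OF assms(1) ab] balancedD[OF assms(2) ab])
  also have "\<dots> = defect a ((e - f) o\<^sub>L b)"
    using assms ab by (simp add: compose_distribs defect_diff_right)
  finally show "defect (a o\<^sub>L (e - f)) b = defect a ((e - f) o\<^sub>L b)" .
qed (use assms in simp)

definition z :: "'h \<Rightarrow>\<^sub>L 'h"
  where "z = T id_blinfun"

lemma z_mem [simp]: "z \<in> A"
  by (simp add: z_def)

text \<open>
  The next three lemmas are the balancing equation with \<open>1\<close> for both arguments, for
  the second, and for the first.
\<close>

lemma z_commutes_balanced:
  assumes "balanced e"
  shows "z o\<^sub>L e = e o\<^sub>L z"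
  using balancedD[OF assms id_mem id_mem] by (simp add: z_def defect_def add.commute)

lemma T_compose_balanced:
  assumes "balanced e" and "a \<in> A"
  shows "T (a o\<^sub>L e) = (T e o\<^sub>L a) + (e o\<^sub>L T a) - (z o\<^sub>L a o\<^sub>L e)"
proof -
  have "(z o\<^sub>L (a o\<^sub>L e)) + T (a o\<^sub>L e) = (T e o\<^sub>L a) + (e o\<^sub>L T a)"
    using balancedD[OF assms id_mem] by (simp add: z_def defect_def)
  then show ?thesis
    by (simp add: compose_assoc eq_diff_eq add.commute)
qed

lemma T_balanced_compose:
  assumes "balanced e" and "b \<in> A"
  shows "T (e o\<^sub>L b) = (T b o\<^sub>L e) + (b o\<^sub>L T e) - (e o\<^sub>L b o\<^sub>L z)"
proof -
  have "(T b o\<^sub>L e) + (b o\<^sub>L T e) = T (e o\<^sub>L b) + (e o\<^sub>L b o\<^sub>L z)"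
    using balancedD[OF assms(1) id_mem assms(2)] by (simp add: z_def defect_def)
  then show ?thesis
    by simp
qed

end

section \<open>Faithful corners\<close>

text \<open>
  An idempotent \<open>p\<close> splits the algebra into four blocks. The two cancellation laws say
  in particular that the upper right block \<open>p A q\<close> is a faithful left module over \<open>p A p\<close>
  and a faithful right module over \<open>q A q\<close>; they transfer what is known about the
  balanced elements \<open>p a q\<close> to arbitrary ones.
\<close>

locale faithful_corner = anti_derivable_map A T
  for A :: "('h::real_normed_vector \<Rightarrow>\<^sub>L 'h) set" and T +
  fixes p q :: "'h \<Rightarrow>\<^sub>L 'h"
  assumes p_mem [simp]: "p \<in> A"
    and p_idem [simp]: "p o\<^sub>L p = p"
    and q_eq: "q = id_blinfun - p"
    and left_faithful: "\<And>s. s \<in> A \<Longrightarrow> (\<And>a. a \<in> A \<Longrightarrow> s o\<^sub>L p o\<^sub>L a o\<^sub>L q = 0) \<Longrightarrow> s o\<^sub>L p = 0"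
    and right_faithful: "\<And>s. s \<in> A \<Longrightarrow> (\<And>a. a \<in> A \<Longrightarrow> p o\<^sub>L a o\<^sub>L q o\<^sub>L s = 0) \<Longrightarrow> q o\<^sub>L s = 0"
begin

lemma q_mem [simp]: "q \<in> A"
  by (simp add: q_eq)

lemma pq [simp]: "p o\<^sub>L q = 0" "q o\<^sub>L p = 0" "q o\<^sub>L q = q"
  by (simp_all add: q_eq compose_distribs)

lemma pq_compose [simp]:
  "p o\<^sub>L (p o\<^sub>L x) = p o\<^sub>L x" "q o\<^sub>L (q o\<^sub>L x) = q o\<^sub>L x"
  "p o\<^sub>L (q o\<^sub>L x) = 0" "q o\<^sub>L (p o\<^sub>L x) = 0"
  by (simp_all flip: compose_assoc)

lemma peirce:
  "x = (p o\<^sub>L x o\<^sub>L p) + (p o\<^sub>L x o\<^sub>L q) + (q o\<^sub>L x o\<^sub>L p) + (q o\<^sub>L x o\<^sub>L q)"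
  by (simp add: q_eq compose_simps)

lemma balanced_p: "balanced p"
  by (rule balanced_idempotent) simp_all

text \<open>
  \<open>p a q\<close> is a difference of idempotents, because \<open>p + p a q\<close> is idempotent.
  The same works for the other off-diagonal block.
\<close>

lemma balanced_upper:
  assumes "a \<in> A"
  shows "balanced (p o\<^sub>L a o\<^sub>L q)"
proof -
  have "balanced (p + (p o\<^sub>L a o\<^sub>L q))"
    using assms by (intro balanced_idempotent) (simp_all add: compose_simps)
  from balanced_diff[OF this balanced_p] show ?thesis
    by simp
qed

lemma balanced_lower:
  assumes "a \<in> A"
  shows "balanced (q o\<^sub>L a o\<^sub>L p)"
proof -
  have "balanced (p + (q o\<^sub>L a o\<^sub>L p))"
    using assms by (intro balanced_idempotent) (simp_all add: compose_simps)
  from balanced_diff[OF this balanced_p] show ?thesis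
    by simp
qed

text \<open>
  Put \<open>s = z a - a z\<close>. Multiplying an element of \<open>p A q\<close> by \<open>a\<close>
  on either side gives a sum of products of off-diagonal elements, all of which commute with \<open>z\<close>. Hence
  \<open>s\<close> annihilates \<open>p A q\<close> from both sides, and faithfulness kills every block of
  \<open>s\<close> except \<open>p s q\<close>. That one vanishes because \<open>z\<close> commutes with
  \<open>p a q\<close> itself.
\<close>

lemma z_central:
  assumes [simp]: "a \<in> A"
  shows "z o\<^sub>L a = a o\<^sub>L z"
proof -
  have zp: "z o\<^sub>L p = p o\<^sub>L z"
    by (rule z_commutes_balanced[OF balanced_p])
  have zq: "z o\<^sub>L q = q o\<^sub>L z"
    by (simp add: q_eq compose_distribs zp)
  have up: "z o\<^sub>L (p o\<^sub>L (b o\<^sub>L q)) = p o\<^sub>L (b o\<^sub>L (q o\<^sub>L z))" if "b \<in> A" for b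
    using z_commutes_balanced[OF balanced_upper[OF that]] by (simp add: compose_assoc)
  have lo: "z o\<^sub>L (q o\<^sub>L (b o\<^sub>L p)) = q o\<^sub>L (b o\<^sub>L (p o\<^sub>L z))" if "b \<in> A" for b
    using z_commutes_balanced[OF balanced_lower[OF that]] by (simp add: compose_assoc)
  define s where "s = (z o\<^sub>L a) - (a o\<^sub>L z)"
  have s_mem: "s \<in> A"
    by (simp add: s_def)
  have "s o\<^sub>L p = 0"
  proof (rule left_faithful[OF s_mem])
    fix b assume [simp]: "b \<in> A"
    have ab: "a o\<^sub>L (p o\<^sub>L (b o\<^sub>L q)) = (p o\<^sub>L ((a o\<^sub>L p o\<^sub>L b) o\<^sub>L q)) + ((q o\<^sub>L (a o\<^sub>L p)) o\<^sub>L (p o\<^sub>L (b o\<^sub>L q)))"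
      by (simp add: q_eq compose_simps)
    have "z o\<^sub>L (a o\<^sub>L (p o\<^sub>L (b o\<^sub>L q))) =
        (z o\<^sub>L (p o\<^sub>L ((a o\<^sub>L p o\<^sub>L b) o\<^sub>L q))) + ((z o\<^sub>L (q o\<^sub>L (a o\<^sub>L p))) o\<^sub>L (p o\<^sub>L (b o\<^sub>L q)))"
      unfolding ab by (simp only: compose_distribs compose_assoc)
    also have "\<dots> = (p o\<^sub>L ((a o\<^sub>L p o\<^sub>L b) o\<^sub>L (q o\<^sub>L z))) + (q o\<^sub>L (a o\<^sub>L (p o\<^sub>L (z o\<^sub>L (p o\<^sub>L (b o\<^sub>L q))))))"
      by (subst up, simp, subst lo, simp) (simp only: compose_assoc)
    also have "\<dots> = (a o\<^sub>L (p o\<^sub>L (b o\<^sub>L q))) o\<^sub>L z"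
      unfolding ab by (simp add: up compose_simps)
    finally show "s o\<^sub>L p o\<^sub>L b o\<^sub>L q = 0"
      by (simp add: s_def compose_simps up)
  qed
  moreover have "q o\<^sub>L s = 0"
  proof (rule right_faithful[OF s_mem])
    fix b assume [simp]: "b \<in> A"
    have ba: "p o\<^sub>L (b o\<^sub>L (q o\<^sub>L a)) = (p o\<^sub>L ((b o\<^sub>L q o\<^sub>L a) o\<^sub>L q)) + ((p o\<^sub>L (b o\<^sub>L q)) o\<^sub>L (q o\<^sub>L (a o\<^sub>L p)))"
      by (simp add: q_eq compose_simps)
    have "z o\<^sub>L (p o\<^sub>L (b o\<^sub>L (q o\<^sub>L a))) =
        (z o\<^sub>L (p o\<^sub>L ((b o\<^sub>L q o\<^sub>L a) o\<^sub>L q))) + ((z o\<^sub>L (p o\<^sub>L (b o\<^sub>L q))) o\<^sub>L (q o\<^sub>L (a o\<^sub>L p)))"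
      unfolding ba by (simp only: compose_distribs compose_assoc)
    also have "\<dots> = (p o\<^sub>L ((b o\<^sub>L q o\<^sub>L a) o\<^sub>L (q o\<^sub>L z))) + (p o\<^sub>L (b o\<^sub>L (q o\<^sub>L (z o\<^sub>L (q o\<^sub>L (a o\<^sub>L p))))))"
      by (subst up, simp, subst up, simp) (simp only: compose_assoc)
    also have "\<dots> = (p o\<^sub>L (b o\<^sub>L (q o\<^sub>L a))) o\<^sub>L z"
      unfolding ba by (simp add: lo compose_simps)
    finally have eq: "z o\<^sub>L (p o\<^sub>L (b o\<^sub>L (q o\<^sub>L a))) = p o\<^sub>L (b o\<^sub>L (q o\<^sub>L (a o\<^sub>L z)))"
      by (simp add: compose_assoc)
    have "z o\<^sub>L (p o\<^sub>L (b o\<^sub>L (q o\<^sub>L a))) = (z o\<^sub>L (p o\<^sub>L (b o\<^sub>L q))) o\<^sub>L a"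
      by (simp only: compose_assoc)
    also have "\<dots> = p o\<^sub>L (b o\<^sub>L (q o\<^sub>L (z o\<^sub>L a)))"
      by (simp only: up[OF \<open>b \<in> A\<close>] compose_assoc)
    finally show "p o\<^sub>L b o\<^sub>L q o\<^sub>L s = 0"
      using eq by (simp add: s_def compose_simps)
  qed
  moreover have "p o\<^sub>L s o\<^sub>L q = 0"
  proof -
    have "p o\<^sub>L s o\<^sub>L q = ((p o\<^sub>L z) o\<^sub>L (a o\<^sub>L q)) - (p o\<^sub>L (a o\<^sub>L (z o\<^sub>L q)))"
      by (simp add: s_def compose_simps)
    also have "p o\<^sub>L z = z o\<^sub>L p"
      by (simp add: zp)
    finally show ?thesis
      by (simp add: compose_assoc zq up)
  qed
  ultimately have "s = 0"
    by (subst peirce[of s]) (simp add: compose_assoc)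
  then show ?thesis
    by (simp add: s_def)
qed

lemma z_center: "z \<in> center A"
  by (simp add: center_def commutator_def z_central)

lemma z_compose_left: "a \<in> A \<Longrightarrow> a o\<^sub>L (z o\<^sub>L x) = z o\<^sub>L (a o\<^sub>L x)"
  using z_central[of a] by (metis compose_assoc)

text \<open>
  Removing the central multiple makes \<open>D 1 = 0\<close> and turns the product formulas for
  \<open>T\<close> into a single one, symmetric in which factor is balanced.
\<close>

definition D :: "('h \<Rightarrow>\<^sub>L 'h) \<Rightarrow> ('h \<Rightarrow>\<^sub>L 'h)"
  where "D a = T a - (z o\<^sub>L a)"

lemma D_mem [simp]: "a \<in> A \<Longrightarrow> D a \<in> A"
  by (simp add: D_def)

lemma D_add: "a \<in> A \<Longrightarrow> b \<in> A \<Longrightarrow> D (a + b) = D a + D b"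
  by (simp add: D_def T_add compose_distribs)

lemma D_zero [simp]: "D 0 = 0"
  by (simp add: D_def)

lemma D_compose:
  assumes "balanced a \<or> balanced b" and [simp]: "a \<in> A" "b \<in> A"
  shows "D (a o\<^sub>L b) = (D b o\<^sub>L a) + (b o\<^sub>L D a) + 2 *\<^sub>R (z o\<^sub>L ((b o\<^sub>L a) - (a o\<^sub>L b)))"
proof -
  have "T (a o\<^sub>L b) = (T b o\<^sub>L a) + (b o\<^sub>L T a) - (z o\<^sub>L a o\<^sub>L b)"
    using assms(1)
  proof
    assume "balanced b"
    then show ?thesis
      by (rule T_compose_balanced) simp
  next
    assume "balanced a"
    moreover have "a o\<^sub>L b o\<^sub>L z = z o\<^sub>L a o\<^sub>L b"
      using z_central[of "a o\<^sub>L b"] by (simp add: compose_assoc)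
    ultimately show ?thesis
      by (simp add: T_balanced_compose)
  qed
  then show ?thesis
    by (simp add: D_def compose_simps z_compose_left algebra_simps scaleR_2)
qed

end

section \<open>Triangular algebras\<close>

text \<open>
  The situation of a projection onto a nonzero proper element of a nest.
\<close>

locale triangular_corner = faithful_corner +
  assumes lower_zero: "a \<in> A \<Longrightarrow> q o\<^sub>L a o\<^sub>L p = 0"
begin

lemma compose_p: "a \<in> A \<Longrightarrow> a o\<^sub>L p = p o\<^sub>L a o\<^sub>L p"
  using lower_zero[of a] by (simp add: q_eq compose_distribs)

lemma q_compose: "a \<in> A \<Longrightarrow> q o\<^sub>L a = q o\<^sub>L a o\<^sub>L q"
  using lower_zero[of a] by (simp add: q_eq compose_distribs)

text \<open>
  The product formula for \<open>p p = p\<close> makes \<open>D p\<close> purely off-diagonal, and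
  triangularity leaves only its upper right block.
\<close>

lemma D_p: "D p = p o\<^sub>L D p o\<^sub>L q"
proof -
  have X: "D p = (D p o\<^sub>L p) + (p o\<^sub>L D p)"
    using D_compose[of p p] by (simp add: balanced_p)
  have "p o\<^sub>L D p = (p o\<^sub>L D p o\<^sub>L p) + (p o\<^sub>L D p)"
    by (subst X) (simp add: compose_simps)
  then have "p o\<^sub>L D p o\<^sub>L p = 0"
    by simp
  moreover have "q o\<^sub>L D p o\<^sub>L q = 0"
    by (subst X) (simp add: compose_simps)
  ultimately show ?thesis
    using lower_zero[of "D p"] by (subst peirce) simp
qed

lemma D_p_compose_p: "D p o\<^sub>L p = 0"
  by (subst D_p) (simp add: compose_assoc)

lemma q_compose_D_p: "q o\<^sub>L D p = 0"
  by (subst D_p) (simp add: compose_assoc)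

text \<open>
  For \<open>r = p a q\<close> we have \<open>r p = 0\<close> and \<open>p r = r\<close>. Expanding
  \<open>D (r p) = 0\<close> determines \<open>p D(r)\<close>, in particular
  \<open>p D(r) p = 0\<close>, and expanding \<open>D (p r)\<close> then gives \<open>D r\<close>.
\<close>

lemma D_upper:
  assumes [simp]: "a \<in> A"
  defines "r \<equiv> p o\<^sub>L a o\<^sub>L q"
  shows "D r = - (2 *\<^sub>R (z o\<^sub>L r))"
proof -
  have [simp]: "r \<in> A" "r o\<^sub>L p = 0" "p o\<^sub>L r = r" and rq: "r = r o\<^sub>L q"
    by (simp_all add: r_def compose_assoc)
  have "D p o\<^sub>L r = (D p o\<^sub>L p) o\<^sub>L r"
    by (simp add: compose_assoc)
  then have Xr: "D p o\<^sub>L r = 0"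
    by (simp add: D_p_compose_p)
  have "r o\<^sub>L D p = r o\<^sub>L (q o\<^sub>L D p)"
    by (subst rq) (simp add: compose_assoc)
  then have rX: "r o\<^sub>L D p = 0"
    by (simp add: q_compose_D_p)
  have "0 = D (r o\<^sub>L p)"
    by simp
  also have "\<dots> = (p o\<^sub>L D r) + 2 *\<^sub>R (z o\<^sub>L r)"
    by (subst D_compose) (simp_all add: balanced_p Xr)
  finally have "p o\<^sub>L D r = - (2 *\<^sub>R (z o\<^sub>L r))"
    by (simp add: eq_neg_iff_add_eq_0)
  then have "p o\<^sub>L D r o\<^sub>L p = - (2 *\<^sub>R (z o\<^sub>L r)) o\<^sub>L p"
    by (rule arg_cong)
  also have "\<dots> = 0"
    by (simp add: compose_simps scaleR_2)
  finally have "D r o\<^sub>L p = 0"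
    by (subst compose_p) simp_all
  moreover have "D (p o\<^sub>L r) = (D r o\<^sub>L p) - 2 *\<^sub>R (z o\<^sub>L r)"
    by (subst D_compose) (simp_all add: balanced_p rX compose_distribs)
  ultimately show ?thesis
    by simp
qed

text \<open>
  For \<open>r\<close> in \<open>p A q\<close> the product \<open>r b\<close> is zero. In its expansion the
  value of \<open>D r\<close> cancels the commutator term, which leaves \<open>D b r = 0\<close>; so
  \<open>D b p = 0\<close> by faithfulness. The product \<open>p b = b\<close> gives the rest. The lower
  right block is treated symmetrically.
\<close>

lemma D_upper_left:
  assumes [simp]: "a \<in> A"
  defines "b \<equiv> p o\<^sub>L a o\<^sub>L p"
  shows "D b = b o\<^sub>L D p"
proof -
  have [simp]: "b \<in> A" "p o\<^sub>L b = b" "b o\<^sub>L p = b"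
    by (simp_all add: b_def compose_assoc)
  have "D b o\<^sub>L p = 0"
  proof (rule left_faithful)
    fix c assume [simp]: "c \<in> A"
    define r where "r = p o\<^sub>L c o\<^sub>L q"
    have [simp]: "r \<in> A" "r o\<^sub>L b = 0"
      by (simp_all add: r_def b_def compose_assoc)
    have [simp]: "balanced r"
      by (simp add: r_def balanced_upper)
    have "0 = D (r o\<^sub>L b)"
      by simp
    also have "\<dots> = (D b o\<^sub>L r) + (b o\<^sub>L D r) + 2 *\<^sub>R (z o\<^sub>L (b o\<^sub>L r))"
      by (subst D_compose) simp_all
    also have "D r = - (2 *\<^sub>R (z o\<^sub>L r))"
      unfolding r_def by (rule D_upper) simp
    finally show "D b o\<^sub>L p o\<^sub>L c o\<^sub>L q = 0"
      by (simp add: compose_simps z_compose_left scaleR_2 r_def)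
  qed simp
  moreover have "D (p o\<^sub>L b) = (D b o\<^sub>L p) + (b o\<^sub>L D p)"
    by (subst D_compose) (simp_all add: balanced_p)
  ultimately show ?thesis
    by simp
qed

lemma D_lower_right:
  assumes [simp]: "a \<in> A"
  defines "b \<equiv> q o\<^sub>L a o\<^sub>L q"
  shows "D b = - (D p o\<^sub>L b)"
proof -
  have [simp]: "b \<in> A" "p o\<^sub>L b = 0" "b o\<^sub>L p = 0"
    by (simp_all add: b_def compose_assoc)
  have "q o\<^sub>L D b = 0"
  proof (rule right_faithful)
    fix c assume [simp]: "c \<in> A"
    define r where "r = p o\<^sub>L c o\<^sub>L q"
    have [simp]: "r \<in> A" "b o\<^sub>L r = 0"
      by (simp_all add: r_def b_def compose_assoc)
    have [simp]: "balanced r"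
      by (simp add: r_def balanced_upper)
    have "0 = D (b o\<^sub>L r)"
      by simp
    also have "\<dots> = (D r o\<^sub>L b) + (r o\<^sub>L D b) + 2 *\<^sub>R (z o\<^sub>L (r o\<^sub>L b))"
      by (subst D_compose) simp_all
    also have "D r = - (2 *\<^sub>R (z o\<^sub>L r))"
      unfolding r_def by (rule D_upper) simp
    finally show "p o\<^sub>L c o\<^sub>L q o\<^sub>L D b = 0"
      by (simp add: compose_simps z_compose_left scaleR_2 r_def)
  qed simp
  moreover have "0 = D (b o\<^sub>L p)"
    by simp
  then have "0 = (D p o\<^sub>L b) + (p o\<^sub>L D b)"
    by (subst (asm) D_compose) (simp_all add: balanced_p)
  ultimately show ?thesis
    by (simp add: q_eq compose_distribs eq_neg_iff_add_eq_0 add.commute)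
qed

text \<open>
  The values on the three blocks are those of the inner derivation
  \<open>a \<mapsto> a v - v a\<close>: the summand \<open>D p\<close> of \<open>v\<close> accounts for the two
  diagonal blocks, and \<open>2 z p\<close> for the factor \<open>- 2 z\<close> on the upper right block,
  since \<open>p a - a p = p a q\<close>.
\<close>

lemma T_eq:
  assumes [simp]: "a \<in> A"
  defines "v \<equiv> D p + 2 *\<^sub>R (z o\<^sub>L p)"
  shows "T a = (a o\<^sub>L (v + z)) - (v o\<^sub>L a)"
proof -
  have "D p o\<^sub>L a = D p o\<^sub>L (q o\<^sub>L a)"
    by (simp add: q_eq compose_distribs D_p_compose_p flip: compose_assoc)
  then have Xa: "D p o\<^sub>L a = D p o\<^sub>L (q o\<^sub>L a o\<^sub>L q)"
    using q_compose[OF assms(1)] by simp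
  have "q o\<^sub>L D p = 0"
    by (rule q_compose_D_p)
  then have "D p = p o\<^sub>L D p"
    by (simp add: q_eq compose_distribs)
  then have "a o\<^sub>L D p = (a o\<^sub>L p) o\<^sub>L D p"
    by (simp add: compose_assoc)
  then have aX: "a o\<^sub>L D p = (p o\<^sub>L a o\<^sub>L p) o\<^sub>L D p"
    by (simp only: compose_p[OF assms(1), symmetric])
  have pa: "p o\<^sub>L a o\<^sub>L q = (p o\<^sub>L a) - (a o\<^sub>L p)"
    using compose_p[OF assms(1)] by (simp add: q_eq compose_distribs)
  have "D a = D ((p o\<^sub>L a o\<^sub>L p) + (p o\<^sub>L a o\<^sub>L q) + (q o\<^sub>L a o\<^sub>L q))"
    using lower_zero[of a] by (subst peirce[of a]) simp
  also have "\<dots> = D (p o\<^sub>L a o\<^sub>L p) + D (p o\<^sub>L a o\<^sub>L q) + D (q o\<^sub>L a o\<^sub>L q)"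
    by (simp add: D_add)
  also have "\<dots> = (a o\<^sub>L D p) - 2 *\<^sub>R (z o\<^sub>L ((p o\<^sub>L a) - (a o\<^sub>L p))) - (D p o\<^sub>L a)"
    by (simp only: D_upper_left[OF assms(1)] D_upper[OF assms(1)] D_lower_right[OF assms(1)])
      (simp only: Xa aX pa, simp)
  finally have "T a = ((a o\<^sub>L D p) - 2 *\<^sub>R (z o\<^sub>L ((p o\<^sub>L a) - (a o\<^sub>L p))) - (D p o\<^sub>L a)) + (z o\<^sub>L a)"
    by (simp only: D_def[of a] diff_eq_eq)
  then show ?thesis
    by (simp only:) (simp add: v_def compose_simps z_central[OF assms(1)] z_compose_left scaleR_2 algebra_simps)
qed

lemma generalized_derivation:
  "\<exists>u\<in>A. \<exists>v\<in>A. u - v \<in> center A \<and> (\<forall>a\<in>A. T a = (a o\<^sub>L u) - (v o\<^sub>L a))"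
proof -
  define v where "v = D p + 2 *\<^sub>R (z o\<^sub>L p)"
  have "v \<in> A"
    by (simp add: v_def scaleR_2)
  moreover have "T a = (a o\<^sub>L (v + z)) - (v o\<^sub>L a)" if "a \<in> A" for a
    unfolding v_def by (rule T_eq[OF that])
  ultimately show ?thesis
    using z_center by (intro bexI[of _ "v + z"] bexI[of _ v]) auto
qed

end

section \<open>Full algebras\<close>

text \<open>
  The situation of a projection in \<open>B(H)\<close>, where the lower left block is large
  enough to admit a cancellation law as well.
\<close>

locale full_corner = faithful_corner +
  assumes left_faithful': "\<And>s. s \<in> A \<Longrightarrow> (\<And>a. a \<in> A \<Longrightarrow> s o\<^sub>L q o\<^sub>L a o\<^sub>L p = 0) \<Longrightarrow> s o\<^sub>L q = 0"
begin

text \<open>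
  Up to a central multiple of a commutator, \<open>D\<close> reverses products, which is hard to
  reconcile with associativity: when \<open>D ((e f) g) = D (e (f g))\<close> is expanded, all terms that
  contain \<open>z\<close> or \<open>D f\<close> cancel, and the commutators remain.
\<close>

lemma D_commutator:
  assumes [simp]: "balanced e" "balanced f" "balanced (e o\<^sub>L f)" "g \<in> A"
  shows "(D g o\<^sub>L commutator e f) + (commutator g f o\<^sub>L D e) = 0"
proof -
  have "D ((e o\<^sub>L f) o\<^sub>L g) = (D g o\<^sub>L (e o\<^sub>L f)) +
      (g o\<^sub>L ((D f o\<^sub>L e) + (f o\<^sub>L D e) + 2 *\<^sub>R (z o\<^sub>L ((f o\<^sub>L e) - (e o\<^sub>L f))))) +
      2 *\<^sub>R (z o\<^sub>L ((g o\<^sub>L (e o\<^sub>L f)) - ((e o\<^sub>L f) o\<^sub>L g)))"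
    by (simp add: D_compose)
  moreover have "D (e o\<^sub>L (f o\<^sub>L g)) =
      (((D g o\<^sub>L f) + (g o\<^sub>L D f) + 2 *\<^sub>R (z o\<^sub>L ((g o\<^sub>L f) - (f o\<^sub>L g)))) o\<^sub>L e) +
      ((f o\<^sub>L g) o\<^sub>L D e) + 2 *\<^sub>R (z o\<^sub>L (((f o\<^sub>L g) o\<^sub>L e) - (e o\<^sub>L (f o\<^sub>L g))))"
    by (simp add: D_compose)
  ultimately have "(D g o\<^sub>L (f o\<^sub>L e)) + (f o\<^sub>L (g o\<^sub>L D e)) =
      (D g o\<^sub>L (e o\<^sub>L f)) + (g o\<^sub>L (f o\<^sub>L D e))"
    by (simp add: compose_simps z_compose_left scaleR_2)
  then show ?thesis
    by (simp add: commutator_def compose_simps algebra_simps)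
qed

text \<open>
  The commutator with \<open>p\<close> is, up to sign, the identity on the off-diagonal blocks, so
  the cancellation laws apply.
\<close>

lemma eq_0_if_commutators:
  assumes "s \<in> A"
    and up: "\<And>a. a \<in> A \<Longrightarrow> s o\<^sub>L commutator p (p o\<^sub>L a o\<^sub>L q) = 0"
    and lo: "\<And>a. a \<in> A \<Longrightarrow> s o\<^sub>L commutator p (q o\<^sub>L a o\<^sub>L p) = 0"
  shows "s = 0"
proof -
  have "s o\<^sub>L p = 0"
    using up by (intro left_faithful[OF assms(1)]) (simp add: commutator_def compose_simps)
  moreover have "s o\<^sub>L q = 0"
    using lo by (intro left_faithful'[OF assms(1)]) (simp add: commutator_def compose_simps)
  ultimately show ?thesis
    by (simp add: q_eq compose_distribs)
qed

lemma balanced_zero: "balanced 0"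
  by (rule balanced_idempotent) simp_all

text \<open>
  With \<open>f = g = p\<close> the second commutator in \<open>D_commutator\<close> is zero.
\<close>

lemma D_p_eq_0: "D p = 0"
proof (rule eq_0_if_commutators)
  fix a assume a: "a \<in> A"
  have "D p o\<^sub>L commutator (p o\<^sub>L a o\<^sub>L q) p = 0"
    using D_commutator[OF balanced_upper[OF a] balanced_p, of p]
    by (simp add: compose_assoc balanced_zero commutator_def[of p p])
  then show "D p o\<^sub>L commutator p (p o\<^sub>L a o\<^sub>L q) = 0"
    by (simp add: commutator_def compose_distribs)
  have "D p o\<^sub>L commutator (q o\<^sub>L a o\<^sub>L p) p = 0"
    using D_commutator[OF balanced_lower[OF a] balanced_p, of p] balanced_lower[OF a]
    by (simp add: compose_assoc balanced_zero commutator_def[of p p])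
  then show "D p o\<^sub>L commutator p (q o\<^sub>L a o\<^sub>L p) = 0"
    by (simp add: commutator_def compose_distribs)
qed simp

text \<open>
  Since \<open>D p = 0\<close>, the choice \<open>e = p\<close> removes the second summand in
  \<open>D_commutator\<close> for every \<open>g\<close>, and \<open>D g = 0\<close> follows.
\<close>

lemma T_eq:
  assumes g: "g \<in> A"
  shows "T g = z o\<^sub>L g"
proof -
  have "D g = 0"
  proof (rule eq_0_if_commutators)
    fix a assume a: "a \<in> A"
    show "D g o\<^sub>L commutator p (p o\<^sub>L a o\<^sub>L q) = 0"
      using D_commutator[OF balanced_p balanced_upper[OF a], of g] balanced_upper[OF a] g
      by (simp add: compose_assoc D_p_eq_0)
    show "D g o\<^sub>L commutator p (q o\<^sub>L a o\<^sub>L p) = 0"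
      using D_commutator[OF balanced_p balanced_lower[OF a], of g] g
      by (simp add: compose_assoc D_p_eq_0 balanced_zero)
  qed (use g in simp)
  then show ?thesis
    by (simp add: D_def)
qed

lemma generalized_derivation:
  "\<exists>u\<in>A. \<exists>v\<in>A. u - v \<in> center A \<and> (\<forall>a\<in>A. T a = (a o\<^sub>L u) - (v o\<^sub>L a))"
proof -
  have "T a = (a o\<^sub>L z) - (0 o\<^sub>L a)" if "a \<in> A" for a
    using T_eq[OF that] z_central[OF that] by simp
  then show ?thesis
    using z_center by (intro bexI[of _ z] bexI[of _ 0]) auto
qed

end

section \<open>Orthogonal projections in Hilbert space\<close>

lemma cinner_add_right: "cinner x (y + z) = cinner x y + cinner x z"
  by (metis cinner_add_left cinner_commute complex_cnj_add)

lemma cinner_scaleC_right: "cinner x (c *\<^sub>C y) = cnj c * cinner x y"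
  by (metis cinner_commute cinner_scaleC_left complex_cnj_mult)

lemma cinner_diff_left: "cinner (x - y) z = cinner x z - cinner y z"
  using cinner_add_left[of "x - y" y z] by simp

lemma cinner_diff_right: "cinner x (y - z) = cinner x y - cinner x z"
  using cinner_add_right[of x "y - z" z] by simp

lemma cinner_zero [simp]: "cinner 0 x = 0" "cinner x 0 = 0"
  using cinner_diff_left[of 0 0 x] cinner_diff_right[of x 0 0] by simp_all

lemma cinner_scaleR_left: "cinner (r *\<^sub>R x) y = complex_of_real r * cinner x y"
  by (simp only: scaleR_scaleC cinner_scaleC_left)

lemma cinner_self_eq_0: "cinner x x = 0 \<longleftrightarrow> x = 0"
  by (simp add: cinner_self)

lemma norm_sq: "(norm x)\<^sup>2 = Re (cinner x x)"
  by (simp add: cinner_self)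

lemma parallelogram:
  fixes x y :: "'a::complex_inner"
  shows "(norm (x + y))\<^sup>2 + (norm (x - y))\<^sup>2 = 2 * (norm x)\<^sup>2 + 2 * (norm y)\<^sup>2"
  by (simp add: norm_sq cinner_add_left cinner_add_right cinner_diff_left cinner_diff_right)

text \<open>
  Subtracting from \<open>x\<close> its component along \<open>y\<close>: the source of both the
  Cauchy-Schwarz inequality and the orthogonality of the nearest point.
\<close>

lemma norm_diff_component:
  fixes x y :: "'a::complex_inner"
  assumes "y \<noteq> 0"
  shows "(norm (x - (cinner x y / (norm y)\<^sup>2) *\<^sub>C y))\<^sup>2 = (norm x)\<^sup>2 - (cmod (cinner x y))\<^sup>2 / (norm y)\<^sup>2"
proof -
  define n where "n = complex_of_real ((norm y)\<^sup>2)"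
  define s where "s = cinner x y"
  have n: "n \<noteq> 0" "cnj n = n" "cinner y y = n"
    using assms by (simp_all add: n_def cinner_self)
  have yx: "cinner y x = cnj s"
    unfolding s_def by (rule cinner_commute)
  have "complex_of_real ((norm (x - (s / n) *\<^sub>C y))\<^sup>2) = cinner (x - (s / n) *\<^sub>C y) (x - (s / n) *\<^sub>C y)"
    by (simp only: cinner_self)
  also have "\<dots> = cinner x x - s * cnj s / n"
    using n by (simp add: cinner_diff_left cinner_diff_right cinner_scaleC_left cinner_scaleC_right yx
      flip: s_def)
  also have "\<dots> = complex_of_real ((norm x)\<^sup>2 - (cmod s)\<^sup>2 / (norm y)\<^sup>2)"
    by (simp only: cinner_self complex_norm_square n_def of_real_diff of_real_divide)
  finally show ?thesis
    unfolding of_real_eq_iff s_def n_def .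
qed

lemma cauchy_schwarz: "cmod (cinner x y) \<le> norm x * norm y"
proof (cases "y = 0")
  case False
  have "0 \<le> (norm x)\<^sup>2 - (cmod (cinner x y))\<^sup>2 / (norm y)\<^sup>2"
    using norm_diff_component[OF False, of x] by (metis zero_le_power2)
  then have "(cmod (cinner x y))\<^sup>2 \<le> (norm x * norm y)\<^sup>2"
    using False by (simp add: field_simps power_mult_distrib)
  then show ?thesis
    by (rule power2_le_imp_le) simp
qed simp

text \<open>
  A minimizing sequence for the distance is Cauchy: by the parallelogram identity and because
  midpoints stay in \<open>N\<close>, two points of \<open>N\<close> that almost realize the distance
  are close to each other.
\<close>

lemma nearest_point_exists:
  fixes x :: "'a::complex_hilbert"
  assumes N: "csubspace N" "closed N"
  shows "\<exists>p\<in>N. \<forall>n\<in>N. norm (x - p) \<le> norm (x - n)"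
proof -
  \<comment> \<open>The infimum of the squared distances, which is what the parallelogram identity
    compares.\<close>
  define d where "d = (INF n\<in>N. (norm (x - n))\<^sup>2)"
  have bdd: "bdd_below ((\<lambda>n. (norm (x - n))\<^sup>2) ` N)"
    by (rule bdd_belowI[of _ 0]) auto
  have N0: "N \<noteq> {}"
    using complex_vector.subspace_0[OF N(1)] by auto
  have d_le: "d \<le> (norm (x - n))\<^sup>2" if "n \<in> N" for n
    unfolding d_def using bdd that by (rule cINF_lower)
  have "\<exists>n\<in>N. (norm (x - n))\<^sup>2 < d + e" if "e > 0" for e
  proof -
    have "Inf ((\<lambda>n. (norm (x - n))\<^sup>2) ` N) < d + e"
      using that by (simp add: d_def)
    from cInf_lessD[OF _ this] show ?thesis
      using N0 by auto
  qed
  then have "\<forall>k. \<exists>n\<in>N. (norm (x - n))\<^sup>2 < d + inverse (real (Suc k))"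
    by simp
  then obtain f where f: "\<And>k. f k \<in> N" "\<And>k. (norm (x - f k))\<^sup>2 < d + inverse (real (Suc k))"
    by metis
  have close: "(norm (n - m))\<^sup>2 \<le> 2 * ((norm (x - n))\<^sup>2 - d) + 2 * ((norm (x - m))\<^sup>2 - d)"
    if "n \<in> N" "m \<in> N" for n m
  proof -
    have "(1/2) *\<^sub>R (n + m) \<in> N"
      unfolding scaleR_scaleC using N(1) that
      by (intro complex_vector.subspace_scale complex_vector.subspace_add)
    then have "4 * d \<le> 4 * (norm (x - (1/2) *\<^sub>R (n + m)))\<^sup>2"
      using d_le by simp
    also have "\<dots> = (norm (2 *\<^sub>R (x - (1/2) *\<^sub>R (n + m))))\<^sup>2"
      by (simp add: power_mult_distrib)
    also have "2 *\<^sub>R (x - (1/2) *\<^sub>R (n + m)) = (x - n) + (x - m)"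
      by (simp add: algebra_simps scaleR_2)
    finally have "4 * d \<le> (norm ((x - n) + (x - m)))\<^sup>2" .
    moreover have "(x - n) - (x - m) = m - n"
      by simp
    ultimately show ?thesis
      using parallelogram[of "x - n" "x - m"] by (simp add: norm_minus_commute)
  qed
  have "Cauchy f"
  proof (rule metric_CauchyI)
    fix e :: real assume "e > 0"
    then have "e\<^sup>2 / 4 > 0"
      by simp
    then obtain M where M: "inverse (real (Suc M)) < e\<^sup>2 / 4"
      using reals_Archimedean by blast
    have small: "(norm (x - f k))\<^sup>2 - d < e\<^sup>2 / 4" if "k \<ge> M" for k
    proof -
      have "inverse (real (Suc k)) \<le> inverse (real (Suc M))"
        using that by (intro le_imp_inverse_le) auto
      then show ?thesis
        using f(2)[of k] M by linarith
    qed
    have "dist (f k) (f l) < e" if "k \<ge> M" "l \<ge> M" for k l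
    proof -
      have "(norm (f k - f l))\<^sup>2 < e\<^sup>2"
        using close[OF f(1) f(1), of k l] small[OF that(1)] small[OF that(2)] by simp
      then show ?thesis
        using \<open>e > 0\<close> by (simp add: dist_norm power_less_imp_less_base)
    qed
    then show "\<exists>M. \<forall>k\<ge>M. \<forall>l\<ge>M. dist (f k) (f l) < e"
      by blast
  qed
  then obtain p where p: "f \<longlonglongrightarrow> p"
    using Cauchy_convergent convergent_def by blast
  have "p \<in> N"
    using N(2) f(1) p by (rule closed_sequentially)
  moreover have "(norm (x - p))\<^sup>2 \<le> d"
  proof (rule LIMSEQ_le)
    show "(\<lambda>k. (norm (x - f k))\<^sup>2) \<longlonglongrightarrow> (norm (x - p))\<^sup>2"
      by (intro tendsto_intros p)
    show "(\<lambda>k. d + inverse (real (Suc k))) \<longlonglongrightarrow> d"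
      using tendsto_add[OF tendsto_const LIMSEQ_inverse_real_of_nat, of d] by simp
    show "\<exists>M. \<forall>k\<ge>M. (norm (x - f k))\<^sup>2 \<le> d + inverse (real (Suc k))"
      using f(2) less_imp_le by blast
  qed
  then have "norm (x - p) \<le> norm (x - n)" if "n \<in> N" for n
    using d_le[OF that] by (meson norm_ge_zero order_trans power2_le_imp_le)
  ultimately show ?thesis
    by blast
qed

text \<open>
  If \<open>x - p\<close> had a component along some \<open>n\<close> in \<open>N\<close>, adding it to the
  nearest point \<open>p\<close> would bring \<open>p\<close> closer to \<open>x\<close>.
\<close>

lemma orthogonal_foot_exists:
  fixes x :: "'a::complex_hilbert"
  assumes N: "csubspace N" "closed N"
  shows "\<exists>p\<in>N. \<forall>n\<in>N. cinner (x - p) n = 0"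
proof -
  obtain p where p: "p \<in> N" "\<And>n. n \<in> N \<Longrightarrow> norm (x - p) \<le> norm (x - n)"
    using nearest_point_exists[OF N] by metis
  have "cinner (x - p) n = 0" if "n \<in> N" for n
  proof (cases "n = 0")
    case False
    define c where "c = cinner (x - p) n / (norm n)\<^sup>2"
    have "p + c *\<^sub>C n \<in> N"
      using N(1) p(1) that by (intro complex_vector.subspace_add complex_vector.subspace_scale)
    then have "(norm (x - p))\<^sup>2 \<le> (norm (x - p - c *\<^sub>C n))\<^sup>2"
      using p(2) by (simp add: diff_diff_eq)
    also have "\<dots> = (norm (x - p))\<^sup>2 - (cmod (cinner (x - p) n))\<^sup>2 / (norm n)\<^sup>2"
      unfolding c_def by (rule norm_diff_component[OF False])
    finally show ?thesis
      using False by (simp add: divide_le_0_iff)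
  qed simp
  with p(1) show ?thesis
    by blast
qed

text \<open>
  Linearity comes from the uniqueness of the foot, boundedness from the Cauchy-Schwarz
  inequality.
\<close>

lemma orthogonal_projection_exists:
  fixes N :: "'a::complex_hilbert set"
  assumes N: "csubspace N" "closed N"
  obtains P where "P \<in> bounded_operators" "\<And>x. blinfun_apply P x \<in> N"
    "\<And>x n. n \<in> N \<Longrightarrow> cinner (x - blinfun_apply P x) n = 0"
proof -
  obtain f where f: "\<And>x. f x \<in> N" "\<And>x n. n \<in> N \<Longrightarrow> cinner (x - f x) n = 0"
    using orthogonal_foot_exists[OF N] by metis
  have unique: "f x = p" if p: "p \<in> N" "\<And>n. n \<in> N \<Longrightarrow> cinner (x - p) n = 0" for x p
  proof -
    have mem: "f x - p \<in> N"
      using N(1) f(1) p(1) by (rule complex_vector.subspace_diff)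
    have "cinner (f x - p) (f x - p) = cinner (x - p) (f x - p) - cinner (x - f x) (f x - p)"
      by (simp flip: cinner_diff_left)
    then show ?thesis
      using f(2)[OF mem] p(2)[OF mem] by (simp add: cinner_self_eq_0)
  qed
  have add: "f (x + y) = f x + f y" for x y
  proof (rule unique)
    show "f x + f y \<in> N"
      using N(1) f(1) f(1) by (rule complex_vector.subspace_add)
    show "cinner (x + y - (f x + f y)) n = 0" if "n \<in> N" for n
      using f(2)[OF that] by (simp add: cinner_add_left cinner_diff_left)
  qed
  have scale: "f (c *\<^sub>C x) = c *\<^sub>C f x" for c x
  proof (rule unique)
    show "c *\<^sub>C f x \<in> N"
      using N(1) f(1) by (rule complex_vector.subspace_scale)
    show "cinner (c *\<^sub>C x - c *\<^sub>C f x) n = 0" if "n \<in> N" for n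
      using f(2)[OF that, of x]
      by (simp add: cinner_scaleC_left flip: complex_vector.scale_right_diff_distrib)
  qed
  have "norm (f x) \<le> norm x * 1" for x
  proof (cases "f x = 0")
    case False
    have "cinner x (f x) = cinner (f x) (f x)"
      using f(2)[OF f(1), of x x] by (simp add: cinner_diff_left)
    then have "norm (f x) * norm (f x) \<le> norm x * norm (f x)"
      using cauchy_schwarz[of x "f x"] by (simp add: cinner_self norm_power power2_eq_square norm_mult)
    then show ?thesis
      using False by simp
  qed simp
  then have "bounded_linear f"
    by (intro bounded_linear_intro[where K = 1]) (simp_all add: add scale scaleR_scaleC)
  then have apply_f: "blinfun_apply (Blinfun f) = f"
    by (rule bounded_linear_Blinfun_apply)
  show thesis
    by (rule that[of "Blinfun f"]) (simp_all add: apply_f bounded_operators_def scale f)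
qed

section \<open>Rank-one operators and cancellation\<close>

lift_definition rank_one :: "'a::complex_inner \<Rightarrow> 'a \<Rightarrow> ('a \<Rightarrow>\<^sub>L 'a)"
  is "\<lambda>x y h. cinner h y *\<^sub>C x"
proof -
  fix x y :: 'a
  show "bounded_linear (\<lambda>h. cinner h y *\<^sub>C x)"
  proof (rule bounded_linear_intro[where K = "norm y * norm x"])
    show "norm (cinner h y *\<^sub>C x) \<le> norm h * (norm y * norm x)" for h
      using mult_right_mono[OF cauchy_schwarz[of h y], of "norm x"]
      by (simp add: norm_scaleC mult.assoc)
  qed (simp_all add: cinner_add_left cinner_scaleR_left scaleC_add_left scaleR_scaleC
      scaleC_scaleC cinner_scaleC_left)
qed

lemma rank_one_mem: "rank_one x y \<in> bounded_operators"
  by (simp add: bounded_operators_def rank_one.rep_eq cinner_scaleC_left scaleC_scaleC)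

locale orthogonal_projection =
  fixes N :: "'h::complex_hilbert set" and P :: "'h \<Rightarrow>\<^sub>L 'h"
  assumes subspace: "csubspace N"
    and P_bounded: "P \<in> bounded_operators"
    and P_mem: "P x \<in> N"
    and orthogonal: "n \<in> N \<Longrightarrow> cinner (x - P x) n = 0"
begin

abbreviation Q :: "'h \<Rightarrow>\<^sub>L 'h"
  where "Q \<equiv> id_blinfun - P"

lemma Q_apply: "Q x = x - P x"
  by (simp add: blinfun.diff_left)

lemma P_id: "n \<in> N \<Longrightarrow> P n = n"
  using orthogonal[of "n - P n" n] complex_vector.subspace_diff[OF subspace _ P_mem, of n n]
  by (simp add: cinner_self_eq_0)

lemma P_idem: "P o\<^sub>L P = P"
  by (rule blinfun_eqI) (simp add: P_id P_mem)

lemma P_zero: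
  assumes "\<And>n. n \<in> N \<Longrightarrow> cinner y n = 0"
  shows "P y = 0"
proof -
  have "cinner (P y) (P y) = cinner y (P y) - cinner (y - P y) (P y)"
    by (simp flip: cinner_diff_left)
  then show ?thesis
    using assms[OF P_mem] orthogonal[OF P_mem] by (simp add: cinner_self_eq_0)
qed

lemma P_scaleC: "P (c *\<^sub>C x) = c *\<^sub>C P x"
  using P_bounded by (simp add: bounded_operators_def)

lemma Q_scaleC: "Q (c *\<^sub>C x) = c *\<^sub>C Q x"
  by (simp add: Q_apply P_scaleC complex_vector.scale_right_diff_distrib)

lemma Q_orthogonal: "n \<in> N \<Longrightarrow> cinner (Q x) n = 0"
  by (simp add: Q_apply orthogonal)

text \<open>
  Rank-one operators are enough for the three cancellation laws of the blocks of \<open>P\<close>. An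
  operator \<open>rank_one x y\<close> with \<open>x\<close> in \<open>N\<close> and \<open>y\<close>
  orthogonal to \<open>N\<close> lies in the upper right block, and exchanging the two vectors gives
  the lower left block.
\<close>

lemma cancel_upper_left:
  assumes "s \<in> bounded_operators" and "y \<noteq> 0" and y: "\<And>n. n \<in> N \<Longrightarrow> cinner y n = 0"
    and zero: "\<And>x. x \<in> N \<Longrightarrow> s o\<^sub>L P o\<^sub>L rank_one x y o\<^sub>L Q = 0"
  shows "s o\<^sub>L P = 0"
proof (rule blinfun_eqI)
  fix h
  have "blinfun_apply (s o\<^sub>L P o\<^sub>L rank_one (P h) y o\<^sub>L Q) y = 0"
    using zero[OF P_mem] by simp
  then have "cinner y y *\<^sub>C s (P h) = 0"
    using assms(1) P_zero[OF y]
    by (simp add: Q_apply rank_one.rep_eq P_scaleC P_id P_mem bounded_operators_def)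
  then show "(s o\<^sub>L P) h = blinfun_apply 0 h"
    using assms(2) by (simp add: cinner_self_eq_0)
qed

lemma cancel_upper_right:
  assumes "x \<noteq> 0" and "x \<in> N"
    and zero: "\<And>y. (\<And>n. n \<in> N \<Longrightarrow> cinner y n = 0) \<Longrightarrow> P o\<^sub>L rank_one x y o\<^sub>L Q o\<^sub>L s = 0"
  shows "Q o\<^sub>L s = 0"
proof (rule blinfun_eqI)
  fix h
  have "blinfun_apply (P o\<^sub>L rank_one x (Q (s h)) o\<^sub>L Q o\<^sub>L s) h = 0"
    by (subst zero) (rule Q_orthogonal, simp_all)
  then have "cinner (Q (s h)) (Q (s h)) *\<^sub>C x = 0"
    using assms(2) by (simp add: rank_one.rep_eq P_scaleC P_id)
  then show "(Q o\<^sub>L s) h = blinfun_apply 0 h"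
    using assms(1) by (simp add: cinner_self_eq_0)
qed

lemma cancel_lower_left:
  assumes "s \<in> bounded_operators" and "x \<noteq> 0" and "x \<in> N"
    and zero: "\<And>y. s o\<^sub>L Q o\<^sub>L rank_one y x o\<^sub>L P = 0"
  shows "s o\<^sub>L Q = 0"
proof (rule blinfun_eqI)
  fix h
  have "blinfun_apply (s o\<^sub>L Q o\<^sub>L rank_one h x o\<^sub>L P) x = 0"
    using zero by simp
  then have "cinner x x *\<^sub>C s (Q h) = 0"
    using assms(1,3) by (simp add: rank_one.rep_eq Q_scaleC P_id bounded_operators_def)
  then show "(s o\<^sub>L Q) h = blinfun_apply 0 h"
    using assms(2) by (simp add: cinner_self_eq_0)
qed

end

lemma orthogonal_projection_of_proper_subspace:
  fixes N :: "'h::complex_hilbert set"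
  assumes "csubspace N" "closed N" "N \<noteq> {0}" "N \<noteq> UNIV"
  obtains P x y where "orthogonal_projection N P" "x \<in> N" "x \<noteq> 0"
    "y \<noteq> 0" "\<And>n. n \<in> N \<Longrightarrow> cinner y n = 0"
proof -
  obtain P where P: "P \<in> bounded_operators" "\<And>x. blinfun_apply P x \<in> N"
    "\<And>x n. n \<in> N \<Longrightarrow> cinner (x - blinfun_apply P x) n = 0"
    using orthogonal_projection_exists[OF assms(1,2)] by metis
  then have proj: "orthogonal_projection N P"
    using assms(1) by unfold_locales
  obtain x where x: "x \<in> N" "x \<noteq> 0"
    using assms(3) complex_vector.subspace_0[OF assms(1)] by blast
  obtain h where "h \<notin> N"
    using assms(4) by blast
  then have "h - P h \<noteq> 0"
    using P(2)[of h] by auto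
  then show thesis
    using that[OF proj x] P(3) by blast
qed

section \<open>Nest algebras\<close>

lemma operator_ring_Alg:
  assumes "subspace_lattice \<L>"
  shows "operator_ring (Alg \<L>)"
proof
  show "id_blinfun \<in> Alg \<L>"
    by (simp add: Alg_def bounded_operators_def)
  have sub: "csubspace L" if "L \<in> \<L>" for L
    using assms that by (simp add: subspace_lattice_def)
  fix a b assume ab: "a \<in> Alg \<L>" "b \<in> Alg \<L>"
  show "a + b \<in> Alg \<L>"
    using ab sub by (auto simp: Alg_def bounded_operators_def blinfun.add_left scaleC_add_right
        image_subset_iff intro!: complex_vector.subspace_add)
  show "a - b \<in> Alg \<L>"
    using ab sub by (auto simp: Alg_def bounded_operators_def blinfun.diff_left
        complex_vector.scale_right_diff_distrib image_subset_iff intro!: complex_vector.subspace_diff)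
  show "a o\<^sub>L b \<in> Alg \<L>"
    using ab by (auto simp: Alg_def bounded_operators_def image_subset_iff)
qed

text \<open>
  The operator maps into \<open>N\<close> and kills \<open>N\<close>, so it leaves invariant every
  subspace below \<open>N\<close> and every subspace above it; in a nest there are no others.
\<close>

lemma rank_one_mem_Alg:
  assumes "subspace_lattice \<L>" and chain: "\<And>K. K \<in> \<L> \<Longrightarrow> K \<subseteq> N \<or> N \<subseteq> K"
    and "x \<in> N" and y: "\<And>n. n \<in> N \<Longrightarrow> cinner y n = 0"
  shows "rank_one x y \<in> Alg \<L>"
proof -
  have "rank_one x y h \<in> K" if "K \<in> \<L>" "h \<in> K" for K h
  proof -
    have K: "csubspace K"
      using assms(1) that(1) by (simp add: subspace_lattice_def)
    from chain[OF that(1)] show ?thesis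
    proof
      assume "K \<subseteq> N"
      then have "cinner h y = 0"
        using y[of h] that(2) cinner_commute[of h y] by auto
      then show ?thesis
        using complex_vector.subspace_0[OF K] by (simp add: rank_one.rep_eq)
    next
      assume "N \<subseteq> K"
      then show ?thesis
        using assms(3) complex_vector.subspace_scale[OF K] by (auto simp: rank_one.rep_eq)
    qed
  qed
  then show ?thesis
    using rank_one_mem by (auto simp: Alg_def)
qed

text \<open>
  The orthogonal complement of a nonzero vector is a closed subspace that is not everything, hence zero. So the
  space is at most one-dimensional.
\<close>

lemma operators_scalar:
  assumes irreducible: "\<forall>N :: 'h set. csubspace N \<longrightarrow> closed N \<longrightarrow> N = {0} \<or> N = UNIV"
    and S: "S \<in> (bounded_operators :: ('h::complex_hilbert \<Rightarrow>\<^sub>L 'h) set)"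
  shows "\<exists>c. S = scale_operator c id_blinfun"
proof (cases "\<exists>x :: 'h. x \<noteq> 0")
  case True
  then obtain x :: 'h where x: "x \<noteq> 0"
    by blast
  \<comment> \<open>The orthogonal complement of \<open>x\<close>, written as a kernel so that it is
    visibly closed.\<close>
  define N where "N = {h. rank_one x x h = 0}"
  have N_iff: "h \<in> N \<longleftrightarrow> cinner h x = 0" for h
    using x by (simp add: N_def rank_one.rep_eq)
  have "csubspace N"
    by (intro complex_vector.subspaceI) (simp_all add: N_iff cinner_add_left cinner_scaleC_left)
  moreover have "closed N"
    unfolding N_def by (intro closed_Collect_eq continuous_intros)
  moreover have "x \<notin> N"
    using x by (simp add: N_iff cinner_self_eq_0)
  ultimately have N: "N = {0}"
    using irreducible by blast
  have line: "h = (cinner h x / cinner x x) *\<^sub>C x" for h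
  proof -
    have "h - (cinner h x / cinner x x) *\<^sub>C x \<in> N"
      using x by (simp add: N_iff cinner_diff_left cinner_scaleC_left cinner_self_eq_0)
    then show ?thesis
      by (simp add: N)
  qed
  obtain c where c: "S x = c *\<^sub>C x"
    using line by blast
  have "S = scale_operator c id_blinfun"
  proof (rule blinfun_eqI)
    fix h
    obtain d where d: "h = d *\<^sub>C x"
      using line by blast
    then show "S h = scale_operator c id_blinfun h"
      using S c by (simp add: bounded_operators_def scale_operator.rep_eq scaleC_scaleC mult.commute)
  qed
  then show ?thesis ..
next
  case False
  then have "S = scale_operator 0 id_blinfun"
    by (intro blinfun_eqI) metis
  then show ?thesis ..
qed

text \<open>
  If the nest has a nonzero proper element, the projection onto it is a triangular corner of \<open>A\<close>.
  Otherwise \<open>A = B(H)\<close>, and the projection onto any nonzero proper closed subspace is a full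
  corner.
  If there is no such subspace, \<open>A\<close> consists of scalars, and \<open>T\<close> is determined by \<open>T 1\<close>.
\<close>

lemma anti_derivable_map_generalized_derivation:
  fixes A :: "('h::complex_hilbert \<Rightarrow>\<^sub>L 'h) set"
  assumes "nest_algebra A" "anti_derivable_map A T" "clinear_on A T"
  shows "\<exists>u\<in>A. \<exists>v\<in>A. u - v \<in> center A \<and> (\<forall>a\<in>A. T a = (a o\<^sub>L u) - (v o\<^sub>L a))"
proof -
  interpret anti_derivable_map A T
    by (rule assms(2))
  obtain \<L> where \<L>: "subspace_lattice \<L>" and chain: "\<And>K L. K \<in> \<L> \<Longrightarrow> L \<in> \<L> \<Longrightarrow> K \<subseteq> L \<or> L \<subseteq> K"
    and A: "A = Alg \<L>"
    using assms(1) unfolding nest_algebra_def by metis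
  have A_bounded: "A \<subseteq> bounded_operators"
    by (auto simp: A Alg_def)
  consider (proper) N where "N \<in> \<L>" "N \<noteq> {0}" "N \<noteq> UNIV"
    | (trivial) N :: "'h set" where "\<L> \<subseteq> {{0}, UNIV}" "csubspace N" "closed N" "N \<noteq> {0}" "N \<noteq> UNIV"
    | (scalar) "\<L> \<subseteq> {{0}, UNIV}" "\<forall>N :: 'h set. csubspace N \<longrightarrow> closed N \<longrightarrow> N = {0} \<or> N = UNIV"
  proof (cases "\<exists>N\<in>\<L>. N \<noteq> {0} \<and> N \<noteq> UNIV")
    case True
    then show thesis
      using proper by blast
  next
    case False
    then have "\<L> \<subseteq> {{0}, UNIV}"
      by auto
    then show thesis
      using trivial scalar by metis
  qed
  then show ?thesis
  proof cases
    case proper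
    have N: "csubspace N" "closed N"
      using \<L> proper(1) by (simp_all add: subspace_lattice_def)
    obtain P x y where P: "orthogonal_projection N P" and xy: "x \<in> N" "x \<noteq> 0"
      "y \<noteq> 0" "\<And>n. n \<in> N \<Longrightarrow> cinner y n = 0"
      using orthogonal_projection_of_proper_subspace[OF N proper(2,3)] by metis
    interpret orthogonal_projection N P
      by (rule P)
    have rank_one: "rank_one x y \<in> A" if "x \<in> N" "\<And>n. n \<in> N \<Longrightarrow> cinner y n = 0" for x y
      unfolding A using rank_one_mem_Alg[OF \<L> _ that] chain[OF _ proper(1)] by blast
    \<comment> \<open>\<open>P\<close> fixes the elements of the nest below \<open>N\<close> pointwise and maps
      into those above \<open>N\<close>.\<close>
    have "P h \<in> K" if "K \<in> \<L>" "h \<in> K" for K h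
      using chain[OF that(1) proper(1)] P_mem[of h] P_id[of h] that(2) by auto
    then have P_A: "P \<in> A"
      using P_bounded by (auto simp: A Alg_def)
    interpret triangular_corner A T P Q
    proof
      show "P \<in> A" by (rule P_A)
      show "P o\<^sub>L P = P" by (rule P_idem)
      show "s o\<^sub>L P = 0" if "s \<in> A" "\<And>a. a \<in> A \<Longrightarrow> s o\<^sub>L P o\<^sub>L a o\<^sub>L Q = 0" for s
        using cancel_upper_left[OF _ xy(3,4)] that rank_one[OF _ xy(4)] A_bounded by blast
      show "Q o\<^sub>L s = 0" if "s \<in> A" "\<And>a. a \<in> A \<Longrightarrow> P o\<^sub>L a o\<^sub>L Q o\<^sub>L s = 0" for s
        using cancel_upper_right[OF xy(2,1)] that rank_one[OF xy(1)] by blast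
      show "Q o\<^sub>L a o\<^sub>L P = 0" if "a \<in> A" for a
      proof (rule blinfun_eqI)
        fix h
        have "a (P h) \<in> N"
          using that proper(1) P_mem by (auto simp: A Alg_def)
        then show "(Q o\<^sub>L a o\<^sub>L P) h = blinfun_apply 0 h"
          by (simp add: Q_apply P_id)
      qed
    qed simp
    show ?thesis
      by (rule generalized_derivation)
  next
    case trivial
    then have A_eq: "A = bounded_operators"
      by (auto simp: A Alg_def bounded_operators_def blinfun.zero_right)
    obtain P x y where P: "orthogonal_projection N P" and xy: "x \<in> N" "x \<noteq> 0"
      "y \<noteq> 0" "\<And>n. n \<in> N \<Longrightarrow> cinner y n = 0"
      using orthogonal_projection_of_proper_subspace[OF trivial(2-5)] by metis
    interpret orthogonal_projection N P
      by (rule P)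
    interpret full_corner A T P Q
    proof
      show "P \<in> A" using P_bounded by (simp add: A_eq)
      show "P o\<^sub>L P = P" by (rule P_idem)
      show "s o\<^sub>L P = 0" if "s \<in> A" "\<And>a. a \<in> A \<Longrightarrow> s o\<^sub>L P o\<^sub>L a o\<^sub>L Q = 0" for s
        using cancel_upper_left[OF _ xy(3,4)] that rank_one_mem unfolding A_eq by blast
      show "Q o\<^sub>L s = 0" if "s \<in> A" "\<And>a. a \<in> A \<Longrightarrow> P o\<^sub>L a o\<^sub>L Q o\<^sub>L s = 0" for s
        using cancel_upper_right[OF xy(2,1)] that rank_one_mem unfolding A_eq by blast
      show "s o\<^sub>L Q = 0" if "s \<in> A" "\<And>a. a \<in> A \<Longrightarrow> s o\<^sub>L Q o\<^sub>L a o\<^sub>L P = 0" for s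
        using cancel_lower_left[OF _ xy(2,1)] that rank_one_mem unfolding A_eq by blast
    qed simp
    show ?thesis
      by (rule generalized_derivation)
  next
    case scalar
    have scalars: "\<exists>c. a = scale_operator c id_blinfun" if "a \<in> A" for a
      using operators_scalar[OF scalar(2)] that A_bounded by (metis subsetD)
    have "z \<in> bounded_operators"
      using A_bounded z_mem by (rule subsetD)
    then have z_comp: "scale_operator c id_blinfun o\<^sub>L z = scale_operator c z"
      "z o\<^sub>L scale_operator c id_blinfun = scale_operator c z" for c
      by (auto intro!: blinfun_eqI simp: scale_operator.rep_eq bounded_operators_def)
    have "T a = a o\<^sub>L z" "z o\<^sub>L a = a o\<^sub>L z" if a: "a \<in> A" for a
    proof -
      obtain c where c: "a = scale_operator c id_blinfun"
        using scalars[OF a] by blast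
      then show "z o\<^sub>L a = a o\<^sub>L z"
        by (simp add: z_comp)
      have "T a = scale_operator c z"
        using assms(3) id_mem unfolding c clinear_on_def z_def by blast
      then show "T a = a o\<^sub>L z"
        by (simp add: c z_comp)
    qed
    then show ?thesis
      by (intro bexI[of _ z] bexI[of _ 0]) (auto simp: center_def commutator_def)
  qed
qed

theorem corollary2p3:
  fixes A :: "('h::complex_hilbert \<Rightarrow>\<^sub>L 'h) set"
    and T :: "('h \<Rightarrow>\<^sub>L 'h) \<Rightarrow> ('h \<Rightarrow>\<^sub>L 'h)"
  assumes "separable_space (euclidean :: 'h topology)"
    and "nest_algebra A"
    and "T \<in> A \<rightarrow> A"
    and "clinear_on A T"
    and "continuous_on A T"
  shows "anti_derivable_at_zero A T \<longleftrightarrow>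
    (\<exists>u\<in>A. \<exists>v\<in>A.
      u - v \<in> center A \<and>
      (\<forall>a\<in>A. T a = (a o\<^sub>L u) - (v o\<^sub>L a)) \<and>
      (\<forall>a\<in>A. \<forall>b\<in>A. a o\<^sub>L b = 0 \<longrightarrow>
        commutator (b o\<^sub>L a) u + 2 *\<^sub>R ((u - v) o\<^sub>L b o\<^sub>L a) = 0))"
proof -
  interpret operator_ring A
    using assms(2) operator_ring_Alg unfolding nest_algebra_def by blast
  show ?thesis
  proof
    assume anti: "anti_derivable_at_zero A T"
    have "anti_derivable_map A T"
      using assms(3,4) anti by unfold_locales (auto simp: clinear_on_def)
    from anti_derivable_map_generalized_derivation[OF assms(2) this assms(4)]
    obtain u v where uv: "u \<in> A" "v \<in> A" "u - v \<in> center A"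
      "\<forall>a\<in>A. T a = (a o\<^sub>L u) - (v o\<^sub>L a)"
      by metis
    with anti show "\<exists>u\<in>A. \<exists>v\<in>A. u - v \<in> center A \<and>
      (\<forall>a\<in>A. T a = (a o\<^sub>L u) - (v o\<^sub>L a)) \<and>
      (\<forall>a\<in>A. \<forall>b\<in>A. a o\<^sub>L b = 0 \<longrightarrow>
        commutator (b o\<^sub>L a) u + 2 *\<^sub>R ((u - v) o\<^sub>L b o\<^sub>L a) = 0)"
      using anti_derivable_at_zero_iff[OF uv(3), of T] by blast
  next
    assume "\<exists>u\<in>A. \<exists>v\<in>A. u - v \<in> center A \<and>
      (\<forall>a\<in>A. T a = (a o\<^sub>L u) - (v o\<^sub>L a)) \<and>
      (\<forall>a\<in>A. \<forall>b\<in>A. a o\<^sub>L b = 0 \<longrightarrow>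
        commutator (b o\<^sub>L a) u + 2 *\<^sub>R ((u - v) o\<^sub>L b o\<^sub>L a) = 0)"
    then obtain u v where "u - v \<in> center A" "\<forall>a\<in>A. T a = (a o\<^sub>L u) - (v o\<^sub>L a)"
      "\<forall>a\<in>A. \<forall>b\<in>A. a o\<^sub>L b = 0 \<longrightarrow>
        commutator (b o\<^sub>L a) u + 2 *\<^sub>R ((u - v) o\<^sub>L b o\<^sub>L a) = 0"
      by blast
    then show "anti_derivable_at_zero A T"
      using anti_derivable_at_zero_iff[of u v T] by blast
  qed
qed

end
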